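(* Let $\mathbb{X}, \mathbb{Y}$ be normed linear spaces over the same field $\mathbb{K}\in\{\mathbb{R},\mathbb{C}\}$ and let $T\in\mathbb{L}(\mathbb{X},\mathbb{Y})$. Let $x\in S_{\mathbb{X}}$. Then $x\in M_T$ if and only if there exist semi-inner-products $[\cdot,\cdot]_{\mathbb{X}}$ on $\mathbb{X}$ and $[\cdot,\cdot]_{\mathbb{Y}}$ on $\mathbb{Y}$ such that for every $z\in\mathbb{X}$, \[ [Tz,Tx]_{\mathbb{Y}}=\|T\|^2\,[z,x]_{\mathbb{X}}. \]
   Context: $S_{\mathbb{X}}=\{x\in\mathbb{X}:\|x\|=1\}$. $\mathbb{L}(\mathbb{X},\mathbb{Y})$ is the space of bounded linear operators from $\mathbb{X}$ to $\mathbb{Y}$ with the operator norm. The norm attainment set of $T$ is $M_T=\{x\in S_{\mathbb{X}}:\|Tx\|=\|T\|\}$. A semi-inner-product (s.i.p.) on a normed space $\mathbb{X}$ over $\mathbb{K}$ is a function $[\cdot,\cdot]:\mathbb{X}\times\mathbb{X}\to\mathbb{K}$ such that for all $\lambda\in\mathbb{K}$, $x,y,z\in\mathbb{X}$: (i) $[x+y,z]=[x,z]+[y,z]$; (ii) $[\lambda x,y]=\lambda[x,y]$; (iii) $[x,x]>0$ whenever $x\neq0$; (iv) $|[x,y]|^2\le[x,x][y,y]$; (v) $[x,\lambda y]=\overline{\lambda}[x,y]$. Semi-inner-products on a normed space are understood to be compatible with its norm, i.e. $[x,x]=\|x\|^2$ for all $x$. *)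

theory Defs
  imports "HOL-Analysis.Analysis" "HOL-Library.Complex_Order"
begin

(* Complex normed spaces.  The underlying real normed space is the restriction of scalars, so the
   norm, the topology and the operator norm onorm are those of real_normed_vector. *)
class complex_normed_vector = real_normed_vector +
  fixes scaleC :: "complex \<Rightarrow> 'a \<Rightarrow> 'a" (infixr \<open>*\<^sub>C\<close> 75)
  assumes scaleC_add_right: "a *\<^sub>C (x + y) = a *\<^sub>C x + a *\<^sub>C y"
    and scaleC_add_left: "(a + b) *\<^sub>C x = a *\<^sub>C x + b *\<^sub>C x"
    and scaleC_scaleC: "a *\<^sub>C (b *\<^sub>C x) = (a * b) *\<^sub>C x"
    and scaleC_of_real: "complex_of_real r *\<^sub>C x = r *\<^sub>R x"
    and norm_scaleC: "norm (a *\<^sub>C x) = cmod a * norm x"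

instantiation complex :: complex_normed_vector
begin

definition scaleC_complex :: "complex \<Rightarrow> complex \<Rightarrow> complex"
  where "scaleC_complex a x = a * x"

instance
  by standard
    (simp_all add: scaleC_complex_def algebra_simps norm_mult scaleR_conv_of_real)

end

locale bounded_clinear = bounded_linear f
  for f :: "'a::complex_normed_vector \<Rightarrow> 'b::complex_normed_vector" +
  assumes scaleC: "f (a *\<^sub>C x) = a *\<^sub>C f x"

definition norm_attainment_set :: "('a::real_normed_vector \<Rightarrow> 'b::real_normed_vector) \<Rightarrow> 'a set"
  where "norm_attainment_set T = {x \<in> sphere 0 1. norm (T x) = onorm T}"

(* One definition for both scalar fields: scale is the scalar multiplication and conj the
   conjugation of the field.  The order on complex is that of Complex_Order, so 0 < z says that
   z is real and positive, and w \<le> z includes that z - w is real. *)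
locale semi_inner_product =
  fixes conj :: "'k::{real_normed_field, order} \<Rightarrow> 'k"
    and scale :: "'k \<Rightarrow> 'a::real_normed_vector \<Rightarrow> 'a"
    and sip :: "'a \<Rightarrow> 'a \<Rightarrow> 'k"
  assumes add_left: "sip (x + y) z = sip x z + sip y z"
    and scale_left: "sip (scale a x) y = a * sip x y"
    and positive: "x \<noteq> 0 \<Longrightarrow> 0 < sip x x"
    and Cauchy_Schwarz: "of_real ((norm (sip x y))\<^sup>2) \<le> sip x x * sip y y"
    and scale_right: "sip x (scale a y) = conj a * sip x y"
    and compatible: "sip x x = of_real ((norm x)\<^sup>2)"

abbreviation real_sip :: "('a::real_normed_vector \<Rightarrow> 'a \<Rightarrow> real) \<Rightarrow> bool"
  where "real_sip \<equiv> semi_inner_product (\<lambda>a. a) scaleR"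

abbreviation complex_sip :: "('a::complex_normed_vector \<Rightarrow> 'a \<Rightarrow> complex) \<Rightarrow> bool"
  where "complex_sip \<equiv> semi_inner_product cnj scaleC"

end

(* The norm identity at z = x gives one direction.  For the other (T nonzero), let g be a functional
   of norm at most 1 with g (T x) = |Tx|; if |Tx| = |T| and |x| = 1, then f = (g o T) / |T| has norm
   at most 1 and f x = 1.  A semi-inner-product compatible with the norm amounts to a free choice of
   one such supporting functional on each line, so the two products can be chosen with
   [y, Tx] = |Tx| g y and [z, x] = f z.  Supporting functionals exist because minimal sublinear
   functionals are linear, and Zorn's lemma provides a minimal one below any sublinear one. *)
theory Submission
  imports Defs
begin

section \<open>The Hahn--Banach theorem\<close>

definition sublinear :: "('a::real_vector \<Rightarrow> real) \<Rightarrow> bool"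
  where "sublinear p \<longleftrightarrow>
    (\<forall>x y. p (x + y) \<le> p x + p y) \<and> (\<forall>c x. 0 \<le> c \<longrightarrow> p (c *\<^sub>R x) = c * p x)"

text \<open>One inequality suffices for homogeneity: applied with \<open>inverse c\<close> at
  \<open>c *\<^sub>R x\<close>, it yields its own converse.\<close>

lemma sublinearI:
  assumes "\<And>x y. p (x + y) \<le> p x + p y"
    and "p 0 = 0"
    and "\<And>c x. 0 < c \<Longrightarrow> p (c *\<^sub>R x) \<le> c * p x"
  shows "sublinear p"
  unfolding sublinear_def
proof (intro conjI allI impI)
  fix c :: real and x
  assume "0 \<le> c"
  show "p (c *\<^sub>R x) = c * p x"
  proof (cases "c = 0")
    case False
    with \<open>0 \<le> c\<close> have "0 < c" by simp
    have "p x \<le> inverse c * p (c *\<^sub>R x)"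
      using assms(3)[of "inverse c" "c *\<^sub>R x"] \<open>0 < c\<close> by simp
    then have "c * p x \<le> p (c *\<^sub>R x)"
      using \<open>0 < c\<close> by (simp add: field_simps)
    with assms(3)[OF \<open>0 < c\<close>, of x] show ?thesis by simp
  qed (simp add: assms(2))
qed (rule assms(1))

lemma sublinear_add: "sublinear p \<Longrightarrow> p (x + y) \<le> p x + p y"
  and sublinear_scale: "sublinear p \<Longrightarrow> 0 \<le> c \<Longrightarrow> p (c *\<^sub>R x) = c * p x"
  by (auto simp: sublinear_def)

lemma sublinear_0: "sublinear p \<Longrightarrow> p 0 = 0"
  using sublinear_scale[of p 0 0] by simp

lemma sublinear_minus: "sublinear p \<Longrightarrow> - p (- x) \<le> p x"
  using sublinear_add[of p x "- x"] sublinear_0[of p] by simp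

lemma sublinear_norm: "sublinear norm"
  by (auto simp: sublinear_def norm_triangle_ineq)

text \<open>The largest sublinear functional below \<open>p\<close> whose value at \<open>- a\<close> is at most \<open>- p a\<close>; a linear
  functional below it is therefore tight at \<open>a\<close>, and a minimal \<open>p\<close> must be odd.\<close>

definition sublinear_shift :: "('a::real_vector \<Rightarrow> real) \<Rightarrow> 'a \<Rightarrow> 'a \<Rightarrow> real"
  where "sublinear_shift p a y = (INF t\<in>{0..}. p (y + t *\<^sub>R a) - t * p a)"

context
  fixes p :: "'a::real_vector \<Rightarrow> real" and a :: 'a
  assumes p: "sublinear p"
begin

text \<open>A real infimum is only usable on a set bounded below; splitting
  \<open>t *\<^sub>R a\<close> as \<open>(y + t *\<^sub>R a) + (- y)\<close> gives a bound
  independent of \<open>t\<close>.\<close>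

lemma bdd_below_sublinear_shift:
  "bdd_below ((\<lambda>t. p (y + t *\<^sub>R a) - t * p a) ` {0..})"
proof (rule bdd_belowI2)
  fix t :: real
  assume "t \<in> {0..}"
  then have "t * p a = p (t *\<^sub>R a)" by (simp add: sublinear_scale[OF p])
  also have "\<dots> \<le> p (y + t *\<^sub>R a) + p (- y)"
    using sublinear_add[OF p, of "y + t *\<^sub>R a" "- y"] by simp
  finally show "- p (- y) \<le> p (y + t *\<^sub>R a) - t * p a" by simp
qed

lemma sublinear_shift_le:
  "0 \<le> t \<Longrightarrow> sublinear_shift p a y \<le> p (y + t *\<^sub>R a) - t * p a"
  unfolding sublinear_shift_def by (rule cINF_lower[OF bdd_below_sublinear_shift]) simp

lemma sublinear_shift_greatest:
  "(\<And>t. 0 \<le> t \<Longrightarrow> m \<le> p (y + t *\<^sub>R a) - t * p a) \<Longrightarrow> m \<le> sublinear_shift p a y"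
  unfolding sublinear_shift_def by (rule cINF_greatest) auto

lemma sublinear_shift_le_self: "sublinear_shift p a y \<le> p y"
  using sublinear_shift_le[of 0 y] by simp

lemma sublinear_shift_minus: "sublinear_shift p a (- a) \<le> - p a"
  using sublinear_shift_le[of 1 "- a"] sublinear_0[OF p] by simp

text \<open>Parameters \<open>t\<close> and \<open>u\<close> for the two summands combine to
  \<open>t + u\<close> for the sum; for a positive factor \<open>c\<close>, the substitution of
  \<open>c * t\<close> for \<open>t\<close> maps the half-line onto itself.\<close>

lemma sublinear_sublinear_shift: "sublinear (sublinear_shift p a)"
proof (rule sublinearI)
  fix x y
  let ?s = "sublinear_shift p a"
  have *: "?s (x + y) \<le> (p (x + t *\<^sub>R a) - t * p a) + (p (y + u *\<^sub>R a) - u * p a)"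
    if "0 \<le> t" "0 \<le> u" for t u
  proof -
    have "?s (x + y) \<le> p ((x + y) + (t + u) *\<^sub>R a) - (t + u) * p a"
      using that by (intro sublinear_shift_le) simp
    also have "(x + y) + (t + u) *\<^sub>R a = (x + t *\<^sub>R a) + (y + u *\<^sub>R a)"
      by (simp add: algebra_simps)
    finally show ?thesis
      using sublinear_add[OF p, of "x + t *\<^sub>R a" "y + u *\<^sub>R a"] by (simp add: algebra_simps)
  qed
  \<comment> \<open>The double infimum is taken one variable at a time: over \<open>u\<close> with
    \<open>t\<close> fixed, then over \<open>t\<close>.\<close>
  have "?s (x + y) - (p (x + t *\<^sub>R a) - t * p a) \<le> ?s y" if "0 \<le> t" for t
    using *[OF that] by (intro sublinear_shift_greatest) (simp add: algebra_simps)
  then have "?s (x + y) - ?s y \<le> ?s x"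
    by (intro sublinear_shift_greatest) (simp add: algebra_simps)
  then show "?s (x + y) \<le> ?s x + ?s y" by simp
next
  have "0 \<le> sublinear_shift p a 0"
    by (rule sublinear_shift_greatest) (simp add: sublinear_scale[OF p])
  with sublinear_shift_le_self[of 0] show "sublinear_shift p a 0 = 0"
    by (simp add: sublinear_0[OF p])
next
  fix c :: real and x
  assume "0 < c"
  have "inverse c * sublinear_shift p a (c *\<^sub>R x) \<le> sublinear_shift p a x"
  proof (rule sublinear_shift_greatest)
    fix t :: real
    assume "0 \<le> t"
    then have "sublinear_shift p a (c *\<^sub>R x) \<le> p (c *\<^sub>R x + (c * t) *\<^sub>R a) - (c * t) * p a"
      using \<open>0 < c\<close> by (intro sublinear_shift_le) simp
    also have "c *\<^sub>R x + (c * t) *\<^sub>R a = c *\<^sub>R (x + t *\<^sub>R a)"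
      by (simp add: algebra_simps)
    also have "p \<dots> = c * p (x + t *\<^sub>R a)"
      using \<open>0 < c\<close> by (simp add: sublinear_scale[OF p] del: scaleR_add_right)
    finally show "inverse c * sublinear_shift p a (c *\<^sub>R x) \<le> p (x + t *\<^sub>R a) - t * p a"
      using \<open>0 < c\<close> by (simp add: field_simps)
  qed
  then show "sublinear_shift p a (c *\<^sub>R x) \<le> c * sublinear_shift p a x"
    using \<open>0 < c\<close> by (simp add: field_simps)
qed

end

section \<open>Minimal sublinear functionals and Zorn's lemma\<close>

lemma sublinear_INF_chain:
  assumes C: "C \<noteq> {}" "\<And>q. q \<in> C \<Longrightarrow> sublinear q" "\<And>q. q \<in> C \<Longrightarrow> q \<le> p"
    and chain: "\<And>q r. q \<in> C \<Longrightarrow> r \<in> C \<Longrightarrow> q \<le> r \<or> r \<le> q"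
  shows "sublinear (\<lambda>x. INF q\<in>C. q x)" and "\<And>r. r \<in> C \<Longrightarrow> (\<lambda>x. INF q\<in>C. q x) \<le> r"
proof -
  have bdd: "bdd_below ((\<lambda>q. q x) ` C)" for x
  proof (rule bdd_belowI2)
    fix q
    assume "q \<in> C"
    then have "q (- x) \<le> p (- x)" "- q (- x) \<le> q x"
      using C(3) sublinear_minus[OF C(2)] by (auto simp: le_fun_def)
    then show "- p (- x) \<le> q x" by simp
  qed
  have lower: "(INF q\<in>C. q x) \<le> r x" if "r \<in> C" for r x
    using cINF_lower[OF bdd that] .
  then show "(\<lambda>x. INF q\<in>C. q x) \<le> r" if "r \<in> C" for r
    using that by (simp add: le_fun_def)
  show "sublinear (\<lambda>x. INF q\<in>C. q x)"
  proof (rule sublinearI)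
    fix x y
    \<comment> \<open>The two infima on the right choose \<open>q\<close> and \<open>r\<close>
      independently; comparability in the chain supplies one \<open>s\<close> below both, whose
      subadditivity then applies.\<close>
    have *: "(INF q\<in>C. q (x + y)) \<le> q x + r y" if qr: "q \<in> C" "r \<in> C" for q r
    proof -
      obtain s where s: "s \<in> C" "s \<le> q" "s \<le> r"
        using chain[OF qr] qr by blast
      have "(INF q\<in>C. q (x + y)) \<le> s (x + y)"
        using lower s(1) .
      also have "\<dots> \<le> s x + s y"
        using sublinear_add[OF C(2)[OF s(1)]] .
      also have "\<dots> \<le> q x + r y"
        using s(2,3) by (intro add_mono) (auto simp: le_fun_def)
      finally show ?thesis .
    qed
    have "(INF q\<in>C. q (x + y)) - q x \<le> (INF r\<in>C. r y)" if "q \<in> C" for q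
      using *[OF that] C(1) by (intro cINF_greatest) (auto simp: algebra_simps)
    then have "(INF q\<in>C. q (x + y)) - (INF r\<in>C. r y) \<le> (INF q\<in>C. q x)"
      using C(1) by (intro cINF_greatest) (auto simp: algebra_simps)
    then show "(INF q\<in>C. q (x + y)) \<le> (INF q\<in>C. q x) + (INF q\<in>C. q y)" by simp
  next
    have "(\<lambda>q. q 0) ` C = {0}"
      using C(1) sublinear_0[OF C(2)] by force
    then show "(INF q\<in>C. q 0) = 0" by simp
  next
    fix c :: real and x
    assume "0 < c"
    have "inverse c * (INF q\<in>C. q (c *\<^sub>R x)) \<le> (INF q\<in>C. q x)"
    proof (rule cINF_greatest[OF C(1)])
      fix r
      assume "r \<in> C"
      with lower[OF this, of "c *\<^sub>R x"]
      show "inverse c * (INF q\<in>C. q (c *\<^sub>R x)) \<le> r x"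
        using \<open>0 < c\<close> by (simp add: sublinear_scale[OF C(2)] field_simps)
    qed
    then show "(INF q\<in>C. q (c *\<^sub>R x)) \<le> c * (INF q\<in>C. q x)"
      using \<open>0 < c\<close> by (simp add: field_simps)
  qed
qed

text \<open>Minimality makes every shift of \<open>q\<close> equal to \<open>q\<close>, which forces
  \<open>q\<close> to be odd. Oddness turns subadditivity at \<open>- x\<close>, \<open>- y\<close>
  into superadditivity and extends homogeneity to negative scalars.\<close>

lemma minimal_sublinear_linear:
  assumes q: "sublinear q"
    and minimal: "\<And>r. sublinear r \<Longrightarrow> r \<le> q \<Longrightarrow> r = q"
  shows "linear q"
proof -
  have "sublinear_shift q a = q" for a
    using minimal sublinear_sublinear_shift[OF q] sublinear_shift_le_self[OF q]
    by (simp add: le_fun_def)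
  then have "q (- a) \<le> - q a" for a
    using sublinear_shift_minus[OF q, of a] by simp
  with sublinear_minus[OF q] have minus: "q (- a) = - q a" for a
    by (metis antisym minus_le_iff)
  show ?thesis
  proof (rule linearI)
    fix x y
    show "q (x + y) = q x + q y"
      using sublinear_add[OF q, of x y] sublinear_add[OF q, of "- x" "- y"] minus[of "x + y"]
      by (simp add: minus)
  next
    fix c x
    show "q (c *\<^sub>R x) = c *\<^sub>R q x"
      using sublinear_scale[OF q, of c x] sublinear_scale[OF q, of "- c" x] minus[of "c *\<^sub>R x"]
      by (cases "0 \<le> c") auto
  qed
qed

lemma ex_linear_le_sublinear:
  assumes p: "sublinear p"
  shows "\<exists>f. linear f \<and> f \<le> p"
proof -
  define A where "A = {q. sublinear q \<and> q \<le> p}"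
  \<comment> \<open>Zorn's lemma is applied to the reversed order, so its maximal element is a
    minimal functional.\<close>
  have "\<exists>m\<in>A. \<forall>r\<in>A. m \<ge> r \<longrightarrow> r = m"
  proof (rule predicate_Zorn)
    show "partial_order_on A (relation_of (\<ge>) A)"
      by (rule partial_order_on_relation_ofI) auto
  next
    fix C
    assume "C \<in> Chains (relation_of (\<ge>) A)"
    then have C: "q \<in> A" "q \<le> r \<or> r \<le> q" if "q \<in> C" "r \<in> C" for q r
      using that unfolding Chains_def relation_of_def by auto
    show "\<exists>u\<in>A. \<forall>q\<in>C. q \<ge> u"
    proof (cases "C = {}")
      case True
      with p show ?thesis by (auto simp: A_def)
    next
      case False
      then obtain r where r: "r \<in> C" by blast
      let ?u = "\<lambda>x. INF q\<in>C. q x"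
      have u: "sublinear ?u" "\<And>q. q \<in> C \<Longrightarrow> ?u \<le> q"
        using False C by (auto simp: A_def intro!: sublinear_INF_chain[where p = p])
      moreover have "?u \<le> p"
        using u(2)[OF r] C(1)[OF r r] unfolding A_def by (blast intro: order_trans)
      ultimately show ?thesis unfolding A_def by blast
    qed
  qed
  then obtain m where m: "sublinear m" "m \<le> p" "\<And>r. sublinear r \<Longrightarrow> r \<le> p \<Longrightarrow> r \<le> m \<Longrightarrow> r = m"
    unfolding A_def by blast
  then have "linear m"
    \<comment> \<open>Whatever lies below \<open>m\<close> also lies below \<open>p\<close>, so
      minimality within \<open>A\<close> is minimality among all sublinear functionals.\<close>
    by (intro minimal_sublinear_linear) (auto intro: order_trans)
  with m(2) show ?thesis by blast
qed

text \<open>The value at \<open>a\<close> is prescribed by passing to a linear functional below the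
  shift of \<open>p\<close>, rather than by extending one from the line through
  \<open>a\<close>.\<close>

theorem Hahn_Banach_support:
  assumes p: "sublinear p"
  obtains f where "linear f" "\<And>y. f y \<le> p y" "f a = p a"
proof -
  obtain f where f: "linear f" "f \<le> sublinear_shift p a"
    using ex_linear_le_sublinear[OF sublinear_sublinear_shift[OF p]] by blast
  then have le: "f y \<le> sublinear_shift p a y" for y by (simp add: le_fun_def)
  then have "f y \<le> p y" for y
    using sublinear_shift_le_self[OF p] order_trans by blast
  moreover have "p a \<le> f a"
    using order_trans[OF le sublinear_shift_minus[OF p]] linear_neg[OF f(1), of a] by simp
  ultimately show thesis using that f(1) by (metis antisym)
qed

section \<open>Supporting functionals and semi-inner-products\<close>

text \<open>Linearity refers to the scalar multiplication \<open>s\<close>, so that one notion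
  serves both fields. At \<open>x = 0\<close> every linear functional of norm at most 1
  qualifies.\<close>

definition supports :: "('k::real_normed_field \<Rightarrow> 'a::real_normed_vector \<Rightarrow> 'a) \<Rightarrow> 'a \<Rightarrow> ('a \<Rightarrow> 'k) \<Rightarrow> bool"
  where "supports s x f \<longleftrightarrow>
    (\<forall>y z. f (y + z) = f y + f z) \<and> (\<forall>a y. f (s a y) = a * f y) \<and>
    (\<forall>y. norm (f y) \<le> norm y) \<and> f x = of_real (norm x)"

text \<open>Collects what the real and complex cases share; \<open>ex_supports\<close> is the only
  ingredient that needs Hahn-Banach.\<close>

locale normed_space_with_supports = vector_space scale
  for conj :: "'k::{real_normed_field, order} \<Rightarrow> 'k"
    and scale :: "'k \<Rightarrow> 'a::real_normed_vector \<Rightarrow> 'a" +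
  assumes norm_scale: "norm (scale a x) = norm a * norm x"
    and conj_mult: "conj (a * b) = conj a * conj b"
    and conj_0: "conj 0 = 0"
    and conj_self: "conj a * a = of_real ((norm a)\<^sup>2)"
    and of_real_le: "of_real r \<le> (of_real s :: 'k) \<longleftrightarrow> r \<le> s"
    and ex_supports: "\<exists>f. supports scale x f"
begin

lemma norm_conj: "norm (conj a) = norm a"
proof (cases "a = 0")
  case False
  have "norm (conj a) * norm a = norm a * norm a"
    using arg_cong[OF conj_self[of a], of norm] by (simp add: norm_mult power2_eq_square)
  with False show ?thesis by simp
qed (simp add: conj_0)

text \<open>Fix a representative \<open>u\<close> and a supporting functional on each line, and set
  \<open>[z, c u]\<close> to \<open>conj c\<close> times \<open>norm u\<close> times the functional
  at \<open>z\<close>. Conjugate homogeneity is then built in, and the choice on the line of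
  \<open>x\<close> is free to be \<open>f\<close>.\<close>

theorem ex_semi_inner_product:
  assumes f: "supports scale x f"
  obtains sip where "semi_inner_product conj scale sip"
    "\<And>z. sip z x = of_real (norm x) * f z"
proof -
  \<comment> \<open>Excluding \<open>c = 0\<close> makes the lines a partition of the space, with
    the origin forming a line of its own.\<close>
  define line where "line y = {scale c y | c. c \<noteq> 0}" for y
  define rep where "rep y = (if x \<in> line y then x else SOME u. u \<in> line y)" for y
  define coef where "coef y = (SOME c. y = scale c (rep y))" for y
  define F where "F = (\<lambda>y. SOME g. supports scale y g)(x := f)"
  define sip where "sip z y = conj (coef y) * of_real (norm (rep y)) * F (rep y) z" for z y
  have F: "supports scale y (F y)" for y
    using someI_ex[OF ex_supports] f by (simp add: F_def)
  have self: "y \<in> line y" for y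
    unfolding line_def by (rule CollectI, rule exI[of _ 1]) simp
  have rep_line: "rep y \<in> line y" for y
    using self[of y] unfolding rep_def by (auto intro: someI)
  have coef: "y = scale (coef y) (rep y)" for y
  proof -
    obtain c where "c \<noteq> 0" "rep y = scale c y"
      using rep_line[of y] by (auto simp: line_def)
    then have "y = scale (inverse c) (rep y)" by simp
    then show ?thesis unfolding coef_def by (rule someI)
  qed
  have line_scale: "line (scale a y) = line y" if "a \<noteq> 0" for a y
  proof (intro equalityI subsetI)
    fix u
    assume "u \<in> line (scale a y)"
    then obtain c where "c \<noteq> 0" "u = scale (c * a) y" by (auto simp: line_def)
    with that show "u \<in> line y" unfolding line_def by (intro CollectI exI[of _ "c * a"]) simp
  next
    fix u
    assume "u \<in> line y"
    then obtain c where "c \<noteq> 0" "u = scale c y" by (auto simp: line_def)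
    with that show "u \<in> line (scale a y)"
      unfolding line_def by (intro CollectI exI[of _ "c / a"]) simp
  qed
  \<comment> \<open>Since \<open>norm y\<close> is the product of the norms of \<open>coef y\<close>
    and \<open>rep y\<close>, the bound on the functional alone gives Cauchy-Schwarz, and also that
    \<open>sip z 0\<close> vanishes.\<close>
  have norm_sip: "norm (sip z y) \<le> norm z * norm y" for z y
  proof -
    have "norm (sip z y) = norm y * norm (F (rep y) z)"
      using arg_cong[OF coef[of y], of norm]
      by (simp add: sip_def norm_mult norm_conj norm_scale)
    also have "\<dots> \<le> norm y * norm z"
      using F[of "rep y"] by (intro mult_left_mono) (auto simp: supports_def)
    finally show ?thesis by (simp add: mult.commute)
  qed
  have sip_self: "sip y y = of_real ((norm y)\<^sup>2)" for y
  proof -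
    have "F (rep y) y = coef y * of_real (norm (rep y))"
      using F[of "rep y"] coef[of y] unfolding supports_def by metis
    then have "sip y y = (conj (coef y) * coef y) * of_real (norm (rep y) * norm (rep y))"
      by (simp add: sip_def)
    also have "\<dots> = of_real ((norm (coef y) * norm (rep y))\<^sup>2)"
      by (simp add: conj_self power2_eq_square)
    also have "norm (coef y) * norm (rep y) = norm y"
      using arg_cong[OF coef[of y], of norm] by (simp add: norm_scale)
    finally show ?thesis .
  qed
  have sip_0: "sip z 0 = 0" for z
    using norm_sip[of z 0] by simp
  have "semi_inner_product conj scale sip"
  proof
    fix y z w a
    show "sip (y + z) w = sip y w + sip z w"
      using F[of "rep w"] by (simp add: sip_def supports_def algebra_simps)
    show "sip (scale a y) z = a * sip y z"
      using F[of "rep z"] by (simp add: sip_def supports_def)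
    show "0 < sip y y" if "y \<noteq> 0"
    proof -
      have "of_real 0 \<le> (of_real ((norm y)\<^sup>2) :: 'k)"
        by (subst of_real_le) simp
      with that show ?thesis by (simp add: sip_self order_less_le)
    qed
    show "of_real ((norm (sip y z))\<^sup>2) \<le> sip y y * sip z z"
      using power_mono[OF norm_sip[of y z], of 2]
      by (simp only: sip_self of_real_mult[symmetric] of_real_le) (simp add: power_mult_distrib)
    show "sip y y = of_real ((norm y)\<^sup>2)" by (rule sip_self)
    show "sip y (scale a z) = conj a * sip y z"
    proof (cases "a = 0 \<or> z = 0")
      case True
      then show ?thesis by (auto simp: sip_0 conj_0)
    next
      case False
      \<comment> \<open>\<open>rep\<close> depends on its argument only through the line, so both
        choices coincide.\<close>
      then have rep: "rep (scale a z) = rep z"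
        by (simp add: rep_def line_scale)
      have "scale (coef (scale a z)) (rep z) = scale (a * coef z) (rep z)"
        using coef[of "scale a z"] coef[of z] unfolding rep by (metis scale_scale)
      \<comment> \<open>A nonzero representative makes the coefficient unique, so the arbitrary
        choice in \<open>coef\<close> is multiplicative here.\<close>
      moreover have "rep z \<noteq> 0"
        using coef[of z] False by auto
      ultimately have "coef (scale a z) = a * coef z" by simp
      then show ?thesis by (simp add: sip_def rep conj_mult)
    qed
  qed
  moreover have "sip z x = of_real (norm x) * f z" for z
  proof (cases "x = 0")
    case False
    have rep: "rep x = x"
      using self[of x] by (simp add: rep_def)
    then have "coef x = 1"
      using coef[of x] False by (metis scale_one scale_right_imp_eq)
    moreover have "conj 1 = 1"
      using conj_self[of 1] by simp
    ultimately show ?thesis by (simp add: sip_def rep F_def)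
  qed (simp add: sip_0)
  ultimately show thesis by (rule that)
qed

end

section \<open>Norm attainment\<close>

lemma norm_attainment_iff_semi_inner_products:
  fixes conj :: "'k::{real_normed_field, order} \<Rightarrow> 'k"
    and sX :: "'k \<Rightarrow> 'a::real_normed_vector \<Rightarrow> 'a"
    and sY :: "'k \<Rightarrow> 'b::real_normed_vector \<Rightarrow> 'b"
  assumes X: "normed_space_with_supports conj sX"
    and Y: "normed_space_with_supports conj sY"
    and T: "bounded_linear T" "\<And>a z. T (sX a z) = sY a (T z)"
    and x: "x \<in> sphere 0 1"
  shows "x \<in> norm_attainment_set T \<longleftrightarrow>
    (\<exists>sipX sipY. semi_inner_product conj sX sipX \<and> semi_inner_product conj sY sipY \<and>
      (\<forall>z. sipY (T z) (T x) = of_real ((onorm T)\<^sup>2) * sipX z x))"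
    (is "?L \<longleftrightarrow> ?R")
proof
  have norm_x: "norm x = 1" using x by simp
  {
    assume ?L
    then have attains: "norm (T x) = onorm T" by (simp add: norm_attainment_set_def)
    obtain g where g: "supports sY (T x) g"
      using normed_space_with_supports.ex_supports[OF Y] by blast
    have "\<exists>f. supports sX x f \<and> (\<forall>z. of_real (onorm T) * f z = g (T z))"
    \<comment> \<open>Dividing by \<open>onorm T\<close> is impossible for the zero operator; both
      sides then vanish and any supporting functional at \<open>x\<close> serves.\<close>
    proof (cases "onorm T = 0")
      case True
      then have "T z = 0" for z using onorm[OF T(1), of z] by simp
      moreover have "g 0 = 0"
        using g unfolding supports_def by (metis add_cancel_right_right)
      ultimately show ?thesis
        using True normed_space_with_supports.ex_supports[OF X, of x] by auto
    next
      case False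
      then have pos: "0 < onorm T" using onorm_pos_le[OF T(1)] by simp
      have "supports sX x (\<lambda>z. g (T z) / of_real (onorm T))"
        unfolding supports_def
      proof (intro conjI allI)
        fix y
        have "norm (g (T y)) \<le> norm (T y)" using g by (simp add: supports_def)
        also have "\<dots> \<le> onorm T * norm y" by (rule onorm[OF T(1)])
        finally show "norm (g (T y) / of_real (onorm T)) \<le> norm y"
          using pos by (simp add: norm_divide field_simps)
      qed (use g pos attains norm_x in
          \<open>simp_all add: supports_def T(2) linear_add[OF bounded_linear.linear[OF T(1)]] add_divide_distrib\<close>)
      with False show ?thesis by (intro exI[of _ "\<lambda>z. g (T z) / of_real (onorm T)"]) simp
    qed
    then obtain f where f: "supports sX x f" "\<And>z. of_real (onorm T) * f z = g (T z)" by blast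
    obtain sipX where sipX: "semi_inner_product conj sX sipX"
      "\<And>z. sipX z x = of_real (norm x) * f z"
      using normed_space_with_supports.ex_semi_inner_product[OF X f(1)] by blast
    obtain sipY where sipY: "semi_inner_product conj sY sipY"
      "\<And>z. sipY z (T x) = of_real (norm (T x)) * g z"
      using normed_space_with_supports.ex_semi_inner_product[OF Y g] by blast
    have "sipY (T z) (T x) = of_real ((onorm T)\<^sup>2) * sipX z x" for z
      by (simp add: sipX(2) sipY(2) attains norm_x power2_eq_square flip: f(2))
    with sipX(1) sipY(1) show ?R by blast
  }
  {
    assume ?R
    then obtain sipX sipY where sip: "semi_inner_product conj sX sipX"
      "semi_inner_product conj sY sipY"
      "\<And>z. sipY (T z) (T x) = of_real ((onorm T)\<^sup>2) * sipX z x" by blast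
    then have "of_real ((norm (T x))\<^sup>2) = (of_real ((onorm T)\<^sup>2 * (norm x)\<^sup>2) :: 'k)"
      using semi_inner_product.compatible[OF sip(1), of x]
        semi_inner_product.compatible[OF sip(2), of "T x"] sip(3)[of x] by simp
    then have "(norm (T x))\<^sup>2 = (onorm T)\<^sup>2"
      unfolding of_real_eq_iff norm_x by simp
    then have "norm (T x) = onorm T"
      using onorm_pos_le[OF T(1)] by simp
    with x show ?L by (simp add: norm_attainment_set_def)
  }
qed

section \<open>Supporting functionals over the real and the complex field\<close>

lemma ex_real_norming_functional:
  fixes x :: "'a::real_normed_vector"
  obtains f where "linear f" "\<And>y. f y \<le> norm y" "f x = norm x"
  using Hahn_Banach_support[OF sublinear_norm] by blast

text \<open>The one-sided bound at \<open>y\<close> and at \<open>- y\<close> together bound the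
  absolute value.\<close>

lemma normed_space_with_supports_real:
  "normed_space_with_supports (\<lambda>a. a) (scaleR :: real \<Rightarrow> 'a::real_normed_vector \<Rightarrow> 'a)"
proof
  fix x :: 'a
  obtain f where f: "linear f" "\<And>y. f y \<le> norm y" "f x = norm x"
    using ex_real_norming_functional by blast
  have "\<bar>f y\<bar> \<le> norm y" for y
    using f(2)[of y] f(2)[of "- y"] linear_neg[OF f(1), of y] by simp
  with f show "\<exists>f. supports scaleR x f"
    unfolding supports_def by (intro exI[of _ f]) (simp add: linear_add linear_scale)
qed (simp_all add: algebra_simps power2_eq_square)

text \<open>A real-linear \<open>f\<close> is the real part of the complex-linear \<open>g y = f y - \<i> f (\<i> y)\<close>; multiplying
  \<open>y\<close> by \<open>cnj (g y)\<close> makes the value real, so the bound on \<open>f\<close> carries over to \<open>g\<close>.\<close>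

lemma ex_supports_complex:
  fixes x :: "'a::complex_normed_vector"
  shows "\<exists>g. supports scaleC x g"
proof -
  obtain f where f: "linear f" "\<And>y. f y \<le> norm y" "f x = norm x"
    using ex_real_norming_functional by blast
  have f_scale: "f (complex_of_real r *\<^sub>C y) = r * f y" for r y
    by (simp add: scaleC_of_real linear_scale[OF f(1)])
  define g where "g y = Complex (f y) (- f (\<i> *\<^sub>C y))" for y
  have add: "g (y + z) = g y + g z" for y z
    by (simp add: g_def complex_eq_iff scaleC_add_right linear_add[OF f(1)])
  have scale: "g (a *\<^sub>C y) = a * g y" for a y
  proof -
    \<comment> \<open>Used for \<open>a\<close> and for \<open>\<i> * a\<close>, this gives the real
      and the imaginary part of the homogeneity of \<open>g\<close>.\<close>
    have *: "f (a *\<^sub>C y) = Re a * f y + Im a * f (\<i> *\<^sub>C y)" for a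
    proof -
      have "a *\<^sub>C y = complex_of_real (Re a) *\<^sub>C y + complex_of_real (Im a) *\<^sub>C (\<i> *\<^sub>C y)"
        by (metis complex_eq mult.commute scaleC_add_left scaleC_scaleC)
      then show ?thesis by (simp add: linear_add[OF f(1)] f_scale)
    qed
    show ?thesis
      using *[of a] *[of "\<i> * a"] by (simp add: g_def complex_eq_iff scaleC_scaleC algebra_simps)
  qed
  have bound: "cmod (g y) \<le> norm y" for y
  proof -
    have "Re (cnj (g y) * g y) \<le> norm (cnj (g y) *\<^sub>C y)"
      using f(2)[of "cnj (g y) *\<^sub>C y"] unfolding scale[symmetric] by (simp add: g_def)
    then have "cmod (g y) * cmod (g y) \<le> cmod (g y) * norm y"
      by (simp add: norm_scaleC cmod_def flip: power2_eq_square)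
    then show ?thesis
      by (cases "g y = 0") auto
  qed
  \<comment> \<open>The real part of \<open>g x\<close> already exhausts the bound
    \<open>norm x\<close> on its modulus, so no imaginary part remains.\<close>
  have "(norm x)\<^sup>2 + (Im (g x))\<^sup>2 \<le> (norm x)\<^sup>2"
    using power_mono[OF bound[of x], of 2] f(3) by (simp add: cmod_power2 g_def)
  then have "g x = of_real (norm x)"
    using f(3) by (simp add: complex_eq_iff g_def)
  with add scale bound show ?thesis unfolding supports_def by blast
qed

lemma normed_space_with_supports_complex:
  "normed_space_with_supports cnj (scaleC :: complex \<Rightarrow> 'a::complex_normed_vector \<Rightarrow> 'a)"
proof
  fix a x
  show "1 *\<^sub>C x = x" for x :: 'a
    using scaleC_of_real[of 1 x] by simp
  show "cnj a * a = of_real ((norm a)\<^sup>2)"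
    by (metis complex_norm_square mult.commute of_real_power)
qed (simp_all add: scaleC_add_right scaleC_add_left scaleC_scaleC norm_scaleC
    ex_supports_complex less_eq_complex_def)

theorem theorem2p1:
  shows "(\<forall>(T :: 'a::real_normed_vector \<Rightarrow> 'b::real_normed_vector) x.
            bounded_linear T \<longrightarrow> x \<in> sphere 0 1 \<longrightarrow>
            (x \<in> norm_attainment_set T \<longleftrightarrow>
              (\<exists>sipX sipY. real_sip sipX \<and> real_sip sipY \<and>
                (\<forall>z. sipY (T z) (T x) = (onorm T)\<^sup>2 * sipX z x)))) \<and>
         (\<forall>(T :: 'c::complex_normed_vector \<Rightarrow> 'd::complex_normed_vector) x.
            bounded_clinear T \<longrightarrow> x \<in> sphere 0 1 \<longrightarrow>
            (x \<in> norm_attainment_set T \<longleftrightarrow>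
              (\<exists>sipX sipY. complex_sip sipX \<and> complex_sip sipY \<and>
                (\<forall>z. sipY (T z) (T x) = complex_of_real ((onorm T)\<^sup>2) * sipX z x))))"
proof (intro conjI allI impI)
  fix T :: "'a \<Rightarrow> 'b" and x :: 'a
  assume T: "bounded_linear T" and x: "x \<in> sphere 0 1"
  have scaleR: "T (a *\<^sub>R z) = a *\<^sub>R T z" for a z
    by (rule linear_scale[OF bounded_linear.linear[OF T]])
  show "x \<in> norm_attainment_set T \<longleftrightarrow>
    (\<exists>sipX sipY. real_sip sipX \<and> real_sip sipY \<and>
      (\<forall>z. sipY (T z) (T x) = (onorm T)\<^sup>2 * sipX z x))"
    using norm_attainment_iff_semi_inner_products[where T = T and sX = scaleR and sY = scaleR,
      OF normed_space_with_supports_real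
      normed_space_with_supports_real T scaleR x]
    \<comment> \<open>Over the reals the embedding \<open>of_real\<close> in the common statement is
      the identity.\<close>
    by (simp only: of_real_eq_id id_apply)
next
  fix T :: "'c \<Rightarrow> 'd" and x :: 'c
  assume T: "bounded_clinear T" and x: "x \<in> sphere 0 1"
  show "x \<in> norm_attainment_set T \<longleftrightarrow>
    (\<exists>sipX sipY. complex_sip sipX \<and> complex_sip sipY \<and>
      (\<forall>z. sipY (T z) (T x) = complex_of_real ((onorm T)\<^sup>2) * sipX z x))"
    by (rule norm_attainment_iff_semi_inner_products[where T = T and sX = scaleC and sY = scaleC,
      OF normed_space_with_supports_complex
      normed_space_with_supports_complex bounded_clinear.axioms(1)[OF T]
      bounded_clinear.scaleC[OF T] x])
qed

end
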